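(* Let $r\ge 1$ be a fixed integer and let $\boldsymbol{\mu}=(\mu_1,\ldots,\mu_r)$ be a probability distribution with $\mu_i>0$ for $i=1,\ldots,r$ (not depending on $n$). Let $K_1,\ldots,K_r,P:\mathbb{N}_0\to\mathbb{N}_0^{r+1}$ be a scaling such that $$\lambda_1(n)\sim c\,\frac{\log n}{n}$$ for some $c>0$. Then $$\lim_{n\to\infty}\mathbb{P}\left[\mathbb{G}(n;\boldsymbol{\mu},\boldsymbol{K}_n,P_n)\text{ has no isolated nodes}\right]=\begin{cases}0 & \text{if } c<1,\\ 1 & \text{if } c>1.\end{cases}$$
   Context: A scaling is a mapping $K_1,\ldots,K_r,P:\mathbb{N}_0\to\mathbb{N}_0^{r+1}$ (with values written $K_{1,n},\ldots,K_{r,n},P_n$) such that $1\le K_{1,n}\le K_{2,n}\le\cdots\le K_{r,n}<P_n$ for all $n=2,3,\ldots$. Write $\boldsymbol{K}_n=(K_{1,n},\ldots,K_{r,n})$. Inhomogeneous random key graph $\mathbb{G}(n;\boldsymbol{\mu},\boldsymbol{K},P)$: the vertex set is $\{v_1,\ldots,v_n\}$. Each node is independently assigned a class in $\{1,\ldots,r\}$, being of class $i$ with probability $\mu_i$. A class-$i$ node $v_x$ is given a key ring $\Sigma_x$ which is a uniformly random subset of $\{1,\ldots,P\}$ of size $K_i$; the random sets $\Sigma_1,\ldots,\Sigma_n$ are independent and identically distributed. Two distinct nodes $v_x,v_y$ are adjacent if and only if $\Sigma_x\cap\Sigma_y\ne\emptyset$. A node is isolated if it has no neighbors. Define, for $i,j=1,\ldots,r$,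 $$p_{ij}(n)=1-\frac{\binom{P_n-K_{i,n}}{K_{j,n}}}{\binom{P_n}{K_{j,n}}},\qquad \lambda_i(n)=\sum_{j=1}^r p_{ij}(n)\mu_j,$$ where $\binom{a}{b}=0$ if $a<b$. All asymptotic statements are for $n\to\infty$; $a_n\sim b_n$ means $\lim_{n\to\infty} a_n/b_n=1$. *)

theory Defs
  imports "HOL-Probability.Probability" "HOL-Library.Landau_Symbols"
begin

text \<open>A scaling with \<open>r\<close> classes: \<open>K i n\<close> is the key ring size \<open>K\<^sub>i\<^sub>,\<^sub>n\<close> of
  class \<open>i \<in> {1..r}\<close>, and \<open>P n\<close> is the key pool size. Values of \<open>K i\<close> for
  \<open>i \<notin> {1..r}\<close> are irrelevant.\<close>

definition scaling :: "nat \<Rightarrow> (nat \<Rightarrow> nat \<Rightarrow> nat) \<Rightarrow> (nat \<Rightarrow> nat) \<Rightarrow> bool" where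
  "scaling r K P \<longleftrightarrow>
     (\<forall>n\<ge>2. 1 \<le> K 1 n \<and> (\<forall>i\<in>{1..<r}. K i n \<le> K (Suc i) n) \<and> K r n < P n)"

text \<open>\<open>pmf_of_set\<close> is meaningful only on finite nonempty sets; here this amounts to
  \<open>K i \<le> P\<close> for every class \<open>i\<close> in the support of \<open>\<mu>\<close>, which a scaling guarantees
  for \<open>n \<ge> 2\<close>.\<close>

definition key_ring_pmf :: "nat pmf \<Rightarrow> (nat \<Rightarrow> nat) \<Rightarrow> nat \<Rightarrow> nat set pmf" where
  "key_ring_pmf \<mu> K P =
     bind_pmf \<mu> (\<lambda>i. pmf_of_set {S. S \<subseteq> {1..P} \<and> card S = K i})"

definition key_graph_edges :: "nat \<Rightarrow> (nat \<Rightarrow> nat set) \<Rightarrow> nat set set" where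
  "key_graph_edges n \<Sigma> =
     {{x, y} | x y. x \<in> {1..n} \<and> y \<in> {1..n} \<and> x \<noteq> y \<and> \<Sigma> x \<inter> \<Sigma> y \<noteq> {}}"

text \<open>The distribution of the edge set of the inhomogeneous random key graph
  \<open>G(n; \<mu>, K, P)\<close> on the vertex set \<open>{1..n}\<close>. The product \<open>Pi_pmf\<close> makes the key rings
  independent and identically distributed; its second argument is only the value
  outside \<open>{1..n}\<close>.\<close>

definition random_key_graph :: "nat \<Rightarrow> nat pmf \<Rightarrow> (nat \<Rightarrow> nat) \<Rightarrow> nat \<Rightarrow> nat set set pmf" where
  "random_key_graph n \<mu> K P =
     map_pmf (key_graph_edges n) (Pi_pmf {1..n} {} (\<lambda>_. key_ring_pmf \<mu> K P))"

definition isolated_node :: "nat set \<Rightarrow> nat set set \<Rightarrow> nat \<Rightarrow> bool" where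
  "isolated_node V E x \<longleftrightarrow> x \<in> V \<and> (\<forall>y\<in>V. {x, y} \<notin> E)"

definition edge_prob :: "(nat \<Rightarrow> nat \<Rightarrow> nat) \<Rightarrow> (nat \<Rightarrow> nat) \<Rightarrow> nat \<Rightarrow> nat \<Rightarrow> nat \<Rightarrow> real" where
  "edge_prob K P i j n =
     1 - real ((P n - K i n) choose K j n) / real (P n choose K j n)"

definition mean_edge_prob ::
    "nat \<Rightarrow> nat pmf \<Rightarrow> (nat \<Rightarrow> nat \<Rightarrow> nat) \<Rightarrow> (nat \<Rightarrow> nat) \<Rightarrow> nat \<Rightarrow> nat \<Rightarrow> real" where
  "mean_edge_prob r \<mu> K P i n = (\<Sum>j=1..r. edge_prob K P i j n * pmf \<mu> j)"

end

theory Submission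
  imports Defs "HOL-Real_Asymp.Real_Asymp"
begin

text \<open>
  Condition on the key ring \<open>S\<close> of a node: the other \<open>n - 1\<close> rings are still independent, so the
  node is isolated with probability \<open>q(S)\<^sup>n\<^sup>-\<^sup>1\<close>, where \<open>q(S)\<close> is the probability that a random ring
  misses \<open>S\<close>. By symmetry \<open>q(S)\<close> depends only on the size of \<open>S\<close>; it is the quantity
  \<open>miss_prob\<close>, equal to \<open>1 - \<lambda>\<^sub>i\<close> at size \<open>K\<^sub>i\<close> and decreasing in the size. Class 1 has the smallest
  rings, so its nodes are the most likely to be isolated, and they decide the threshold.
  Write \<open>\<lambda> = \<lambda>\<^sub>1(n)\<close>.

  If \<open>c > 1\<close>, the expected number of isolated nodes is at most \<open>n (1 - \<lambda>)\<^sup>n\<^sup>-\<^sup>1\<close>, which is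
  \<open>n\<^sup>1\<^sup>-\<^sup>c\<close> up to a factor \<open>exp(o(ln n))\<close> and tends to 0; a union bound finishes this case (\<open>prob_no_isolated_ge\<close>).

  If \<open>c < 1\<close>, count only the isolated nodes whose ring has size \<open>K\<^sub>1\<close>. The
  size serves in place of the class because it is determined by the key ring. Their expected
  number is at least \<open>\<mu>\<^sub>1 n (1 - \<lambda>)\<^sup>n\<^sup>-\<^sup>1\<close>, which tends to infinity, so by Chebyshev's
  inequality it is enough that two such events are asymptotically uncorrelated
  (\<open>prob_no_event_le\<close>, \<open>prob_no_isolated_le\<close>). Two isolated nodes have disjoint rings, and the
  remaining \<open>n - 2\<close> rings must miss a set of size \<open>2 K\<^sub>1\<close>. Log-concavity of \<open>m \<mapsto> binomial(m, k)\<close>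
  says that for a ring of a fixed size, missing both sets is at most as likely as if the
  two were missed independently. The only positive correlation left comes from the random class \<open>J\<close>
  of the third node: the probability of missing both is at most \<open>(1 - \<lambda>)\<^sup>2 + Var(p\<^sub>1\<^sub>J)\<close>. Since
  \<open>\<mu>\<^sub>j p\<^sub>1\<^sub>j \<le> \<lambda>\<close> for every \<open>j\<close>, that variance is at most \<open>\<lambda>\<^sup>2 / min \<mu>\<close>
  (\<open>miss_prob_double_le\<close>), and over the \<open>n - 2\<close> other nodes it contributes a factor
  \<open>exp(O(n \<lambda>\<^sup>2))\<close>, which tends to 1 because \<open>\<lambda>\<close> is of order \<open>ln n / n\<close>.
\<close>

section \<open>Mixtures of distributions\<close>

text \<open>Both sides are point masses at \<open>True\<close> once \<open>A\<close> is turned into a Boolean, so the formula for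
  the mass of a single point under \<open>bind_pmf\<close> applies.\<close>

lemma prob_bind_pmf:
  "measure_pmf.prob (bind_pmf p f) A = (\<integral>x. measure_pmf.prob (f x) A \<partial>measure_pmf p)"
proof -
  have bool: "measure_pmf.prob q A = pmf (map_pmf (\<lambda>x. x \<in> A) q) True" for q
    by (simp add: pmf_map vimage_def)
  show ?thesis
    unfolding bool by (simp add: map_bind_pmf pmf_bind)
qed

text \<open>A two-stage experiment whose event can only occur when the first stage lands in \<open>B\<close>.\<close>

lemma prob_bind_pmf_le:
  assumes "\<And>x. x \<in> set_pmf p \<Longrightarrow> x \<in> B \<Longrightarrow> measure_pmf.prob (f x) A \<le> u"
    and "\<And>x. x \<in> set_pmf p \<Longrightarrow> x \<notin> B \<Longrightarrow> measure_pmf.prob (f x) A = 0"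
  shows "measure_pmf.prob (bind_pmf p f) A \<le> measure_pmf.prob p B * u"
proof -
  have "measure_pmf.prob (bind_pmf p f) A \<le> (\<integral>x. indicator B x * u \<partial>measure_pmf p)"
    unfolding prob_bind_pmf
  proof (rule integral_mono_AE)
    show "integrable (measure_pmf p) (\<lambda>x. measure_pmf.prob (f x) A)"
      by (rule measure_pmf.integrable_const_bound[where B = 1]) auto
    show "integrable (measure_pmf p) (\<lambda>x. indicator B x * u)"
      by (rule measure_pmf.integrable_const_bound[where B = "\<bar>u\<bar>"]) (auto simp: indicator_def)
  qed (auto simp: AE_measure_pmf_iff indicator_def assms)
  then show ?thesis by simp
qed

lemma prob_bind_pmf_eq:
  assumes "\<And>x. x \<in> set_pmf p \<Longrightarrow> x \<in> B \<Longrightarrow> measure_pmf.prob (f x) A = u"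
    and "\<And>x. x \<in> set_pmf p \<Longrightarrow> x \<notin> B \<Longrightarrow> measure_pmf.prob (f x) A = 0"
  shows "measure_pmf.prob (bind_pmf p f) A = measure_pmf.prob p B * u"
proof -
  have "measure_pmf.prob (bind_pmf p f) A = (\<integral>x. indicator B x * u \<partial>measure_pmf p)"
    unfolding prob_bind_pmf
    by (rule integral_cong_AE) (auto simp: AE_measure_pmf_iff indicator_def assms)
  then show ?thesis by simp
qed

text \<open>Drawing one coordinate first is how the ring of a given node gets conditioned on.\<close>

lemma Pi_pmf_insert_bind:
  assumes "finite W" "x \<notin> W"
  shows "Pi_pmf (insert x W) d p = bind_pmf (p x) (\<lambda>S. map_pmf (\<lambda>f. f(x := S)) (Pi_pmf W d p))"
  using Pi_pmf_insert'[OF assms] by (simp add: map_pmf_def)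

section \<open>Isolation for independent random sets\<close>

definition avoids_others :: "'b set \<Rightarrow> ('b \<Rightarrow> 'a set) \<Rightarrow> 'b \<Rightarrow> bool" where
  "avoids_others V f x \<longleftrightarrow> (\<forall>y\<in>V - {x}. f x \<inter> f y = {})"

lemma prob_all_disjoint:
  assumes "finite W"
  shows "measure_pmf.prob (Pi_pmf W d (\<lambda>_. D)) {f. \<forall>y\<in>W. S \<inter> f y = {}}
         = measure_pmf.prob D {T. S \<inter> T = {}} ^ card W"
proof -
  have "{f. \<forall>y\<in>W. S \<inter> f y = {}} = Pi W (\<lambda>_. {T. S \<inter> T = {}})"
    by auto
  then show ?thesis using assms by (simp add: measure_Pi_pmf_Pi)
qed

text \<open>Given the set \<open>S\<close> at \<open>x\<close>, the other sets are independent and each misses \<open>S\<close> with probability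
  \<open>u\<close>, whatever \<open>S \<in> B\<close> is.\<close>

lemma prob_avoids_others_eq:
  fixes D :: "'a set pmf"
  assumes "finite V" "x \<in> V"
    and q: "\<And>S. S \<in> set_pmf D \<Longrightarrow> S \<in> B \<Longrightarrow> measure_pmf.prob D {T. S \<inter> T = {}} = u"
  shows "measure_pmf.prob (Pi_pmf V {} (\<lambda>_. D)) {f. f x \<in> B \<and> avoids_others V f x}
         = measure_pmf.prob D B * u ^ (card V - 1)"
proof -
  define W where "W = V - {x}"
  have V: "V = insert x W" "finite W" "x \<notin> W" "card W = card V - 1"
    using assms by (auto simp: W_def)
  let ?A = "{f. f x \<in> B \<and> avoids_others V f x}"
  have pre: "(\<lambda>f. f(x := S)) -` ?A = (if S \<in> B then {f. \<forall>y\<in>W. S \<inter> f y = {}} else {})" for S :: "'a set"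
    using V by (auto simp: avoids_others_def)
  show ?thesis
    unfolding V(1) Pi_pmf_insert_bind[OF V(2,3)]
    unfolding V(1)[symmetric] measure_map_pmf
    by (rule prob_bind_pmf_eq[where B = B]) (simp_all only: measure_map_pmf pre, simp_all add: prob_all_disjoint V(2) q V(4))
qed

lemma prob_avoids_others_le:
  fixes D :: "'a set pmf"
  assumes "finite V" "x \<in> V"
    and q: "\<And>S. S \<in> set_pmf D \<Longrightarrow> measure_pmf.prob D {T. S \<inter> T = {}} \<le> u"
  shows "measure_pmf.prob (Pi_pmf V {} (\<lambda>_. D)) {f. avoids_others V f x} \<le> u ^ (card V - 1)"
proof -
  define W where "W = V - {x}"
  have V: "V = insert x W" "finite W" "x \<notin> W" "card W = card V - 1"
    using assms by (auto simp: W_def)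
  have pre: "(\<lambda>f. f(x := S)) -` {f. avoids_others V f x} = {f. \<forall>y\<in>W. S \<inter> f y = {}}" for S :: "'a set"
    using V by (auto simp: avoids_others_def)
  have "measure_pmf.prob (Pi_pmf V {} (\<lambda>_. D)) {f. avoids_others V f x}
        \<le> measure_pmf.prob D UNIV * u ^ (card V - 1)"
    unfolding V(1) Pi_pmf_insert_bind[OF V(2,3)]
    unfolding V(1)[symmetric]
    by (rule prob_bind_pmf_le[where B = UNIV])
       (simp_all only: measure_map_pmf pre, simp_all add: prob_all_disjoint V(2) V(4) power_mono q)
  then show ?thesis by simp
qed

text \<open>Two nodes are both isolated only if their sets are disjoint and every other set misses the union.\<close>

lemma prob_two_avoid_others_le:
  fixes D :: "'a set pmf"
  assumes "finite V" "x \<in> V" "y \<in> V" "x \<noteq> y" "0 \<le> u"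
    and q: "\<And>S T. S \<in> set_pmf D \<Longrightarrow> T \<in> set_pmf D \<Longrightarrow> S \<in> B \<Longrightarrow> T \<in> B \<Longrightarrow> S \<inter> T = {}
              \<Longrightarrow> measure_pmf.prob D {R. (S \<union> T) \<inter> R = {}} \<le> u"
  shows "measure_pmf.prob (Pi_pmf V {} (\<lambda>_. D))
           ({f. f x \<in> B \<and> avoids_others V f x} \<inter> {f. f y \<in> B \<and> avoids_others V f y})
         \<le> measure_pmf.prob D B ^ 2 * u ^ (card V - 2)" (is "measure_pmf.prob _ ?A \<le> _")
proof -
  define W where "W = V - {x, y}"
  have V: "V = insert x (insert y W)" "finite W" "finite (insert y W)" "x \<notin> insert y W" "y \<notin> W"
      "card W = card V - 2"
    using assms by (auto simp: W_def card_Diff_subset)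
  have Vx: "V - {x} = insert y W" and Vy: "V - {y} = insert x W"
    using assms by (auto simp: W_def)
  have pre: "(\<lambda>f. f(y := T)) -` ((\<lambda>f. f(x := S)) -` ?A)
      = (if S \<in> B \<and> T \<in> B \<and> S \<inter> T = {} then {f. \<forall>z\<in>W. (S \<union> T) \<inter> f z = {}} else {})" for S T :: "'a set"
  proof -
    have upd: "\<forall>z\<in>W. (f(y := T, x := S)) z = f z" for f
      by (simp add: W_def)
    have "avoids_others V (f(y := T, x := S)) x \<longleftrightarrow> S \<inter> T = {} \<and> (\<forall>z\<in>W. S \<inter> f z = {})" for f
      unfolding avoids_others_def Vx using upd[of f] assms(4) by simp
    moreover have "avoids_others V (f(y := T, x := S)) y \<longleftrightarrow> S \<inter> T = {} \<and> (\<forall>z\<in>W. T \<inter> f z = {})" for f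
      unfolding avoids_others_def Vy using upd[of f] assms(4) by (simp add: Int_commute)
    ultimately show ?thesis
      using assms(4) by (auto simp: Int_Un_distrib2)
  qed
  have inner: "measure_pmf.prob (Pi_pmf (insert y W) {} (\<lambda>_. D)) ((\<lambda>f. f(x := S)) -` ?A)
      \<le> measure_pmf.prob D B * u ^ card W" if "S \<in> set_pmf D" "S \<in> B" for S
    unfolding Pi_pmf_insert_bind[OF V(2,5)]
  proof (rule prob_bind_pmf_le[where B = B and u = "u ^ card W"])
    fix T assume T: "T \<in> set_pmf D" "T \<in> B"
    have "measure_pmf.prob (Pi_pmf W {} (\<lambda>_. D)) {f. \<forall>z\<in>W. (S \<union> T) \<inter> f z = {}} \<le> u ^ card W"
      if "S \<inter> T = {}"
      unfolding prob_all_disjoint[OF V(2)]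
      by (rule power_mono) (use q T \<open>S \<in> set_pmf D\<close> \<open>S \<in> B\<close> that in blast, rule measure_nonneg)
    then show "measure_pmf.prob (map_pmf (\<lambda>f. f(y := T)) (Pi_pmf W {} (\<lambda>_. D)))
        ((\<lambda>f. f(x := S)) -` ?A) \<le> u ^ card W"
      unfolding measure_map_pmf pre using assms(5) by (cases "S \<inter> T = {}") simp_all
  next
    fix T assume "T \<notin> B"
    then show "measure_pmf.prob (map_pmf (\<lambda>f. f(y := T)) (Pi_pmf W {} (\<lambda>_. D)))
        ((\<lambda>f. f(x := S)) -` ?A) = 0"
      unfolding measure_map_pmf pre by simp
  qed
  have "measure_pmf.prob (Pi_pmf V {} (\<lambda>_. D)) ?A
        \<le> measure_pmf.prob D B * (measure_pmf.prob D B * u ^ card W)"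
    unfolding V(1) Pi_pmf_insert_bind[OF V(3,4)]
    unfolding V(1)[symmetric]
  proof (rule prob_bind_pmf_le[where B = B and u = "measure_pmf.prob D B * u ^ card W"])
    fix S assume "S \<notin> B"
    then have empty: "(\<lambda>f. f(x := S)) -` ?A = {}" by auto
    show "measure_pmf.prob (map_pmf (\<lambda>f. f(x := S)) (Pi_pmf (insert y W) {} (\<lambda>_. D))) ?A = 0"
      unfolding measure_map_pmf empty by simp
  qed (use inner in \<open>simp only: measure_map_pmf\<close>)
  then show ?thesis by (simp add: V(6) power2_eq_square mult.assoc)
qed

section \<open>The second moment method\<close>

text \<open>Chebyshev's inequality for the number \<open>Z\<close> of events that occur: on the event that \<open>Z = 0\<close> the square
  \<open>(Z - E Z)\<^sup>2\<close> is \<open>(E Z)\<^sup>2\<close>, so the probability is at most \<open>E(Z\<^sup>2) / (E Z)\<^sup>2 - 1\<close>. In \<open>E(Z\<^sup>2)\<close> the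
  diagonal pairs give the first term of the bound and the others the second.\<close>

lemma prob_no_event_le:
  fixes A :: "'b \<Rightarrow> 'a set" and M :: "'a pmf" and a b :: real
  assumes "finite V" "V \<noteq> {}" "0 < a" "0 \<le> b"
    and a: "\<And>x. x \<in> V \<Longrightarrow> measure_pmf.prob M (A x) = a"
    and b: "\<And>x y. x \<in> V \<Longrightarrow> y \<in> V \<Longrightarrow> x \<noteq> y \<Longrightarrow> measure_pmf.prob M (A x \<inter> A y) \<le> b"
  shows "measure_pmf.prob M {\<omega>. \<forall>x\<in>V. \<omega> \<notin> A x} \<le> 1 / (card V * a) + b / a\<^sup>2 - 1"
proof -
  define N where "N = real (card V)"
  have N: "N \<ge> 1" using assms by (simp add: N_def Suc_le_eq card_gt_0_iff)
  define Z where "Z = (\<lambda>\<omega>. \<Sum>x\<in>V. indicator (A x) \<omega> :: real)"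
  have int: "integrable (measure_pmf M) (indicator X :: _ \<Rightarrow> real)" for X
    by (intro measure_pmf.integrable_const_bound[where B = 1]) (auto simp: indicator_def)
  have Z2: "Z \<omega> * Z \<omega> = (\<Sum>x\<in>V. \<Sum>y\<in>V. indicator (A x \<inter> A y) \<omega>)" for \<omega>
    by (simp add: Z_def sum_product indicator_inter_arith)
  have intZ: "integrable (measure_pmf M) Z" "integrable (measure_pmf M) (\<lambda>\<omega>. Z \<omega> * Z \<omega>)"
    unfolding Z2 by (simp_all add: Z_def int)
  have EZ: "measure_pmf.expectation M Z = N * a"
    by (simp add: Z_def int a N_def)
  have row: "(\<Sum>y\<in>V. measure_pmf.prob M (A x \<inter> A y)) \<le> a + (N - 1) * b" if "x \<in> V" for x
  proof -
    have "(\<Sum>y\<in>V. measure_pmf.prob M (A x \<inter> A y))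
        = a + (\<Sum>y\<in>V - {x}. measure_pmf.prob M (A x \<inter> A y))"
      using that a[OF that] assms(1) by (simp add: sum.remove)
    also have "(\<Sum>y\<in>V - {x}. measure_pmf.prob M (A x \<inter> A y)) \<le> (\<Sum>y\<in>V - {x}. b)"
      using that b by (intro sum_mono) auto
    also have "\<dots> = (N - 1) * b"
      using that assms(1) N by (simp add: N_def of_nat_diff)
    finally show ?thesis by simp
  qed
  have "measure_pmf.expectation M (\<lambda>\<omega>. Z \<omega> * Z \<omega>)
      = (\<Sum>x\<in>V. \<Sum>y\<in>V. measure_pmf.prob M (A x \<inter> A y))"
    unfolding Z2 by (simp add: int)
  also have "\<dots> \<le> (\<Sum>x\<in>V. a + (N - 1) * b)"
    using row by (rule sum_mono)
  also have "\<dots> = N * a + N * (N - 1) * b"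
    by (simp add: N_def algebra_simps)
  finally have EZ2: "measure_pmf.expectation M (\<lambda>\<omega>. Z \<omega> * Z \<omega>) \<le> N * a + N * (N - 1) * b" .
  have "(N * a)\<^sup>2 * measure_pmf.prob M {\<omega>. \<forall>x\<in>V. \<omega> \<notin> A x}
      = (\<integral>\<omega>. (N * a)\<^sup>2 * indicator {\<omega>. \<forall>x\<in>V. \<omega> \<notin> A x} \<omega> \<partial>measure_pmf M)"
    by simp
  also have "\<dots> \<le> (\<integral>\<omega>. Z \<omega> * Z \<omega> - 2 * (N * a) * Z \<omega> + (N * a)\<^sup>2 \<partial>measure_pmf M)"
  proof (rule integral_mono)
    fix \<omega>
    have "Z \<omega> = 0" if "\<forall>x\<in>V. \<omega> \<notin> A x"
      using that by (simp add: Z_def)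
    moreover have "Z \<omega> * Z \<omega> - 2 * (N * a) * Z \<omega> + (N * a)\<^sup>2 = (Z \<omega> - N * a)\<^sup>2"
      by (simp add: power2_eq_square algebra_simps)
    ultimately show "(N * a)\<^sup>2 * indicator {\<omega>. \<forall>x\<in>V. \<omega> \<notin> A x} \<omega>
        \<le> Z \<omega> * Z \<omega> - 2 * (N * a) * Z \<omega> + (N * a)\<^sup>2"
      by (auto simp: indicator_def)
  qed (use intZ int in simp_all)
  also have "\<dots> = measure_pmf.expectation M (\<lambda>\<omega>. Z \<omega> * Z \<omega>) - (N * a)\<^sup>2"
    using intZ by (simp add: EZ power2_eq_square)
  also have "\<dots> \<le> N * a + N * (N - 1) * b - (N * a)\<^sup>2"
    using EZ2 by simp
  also have "\<dots> \<le> N * a + N\<^sup>2 * b - (N * a)\<^sup>2"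
    using N \<open>0 \<le> b\<close> by (simp add: power2_eq_square algebra_simps)
  also have "\<dots> = (N * a)\<^sup>2 * (1 / (N * a) + b / a\<^sup>2 - 1)"
    using N \<open>0 < a\<close> by (simp add: power2_eq_square right_diff_distrib distrib_left)
  finally show ?thesis
    using N \<open>0 < a\<close> unfolding N_def[symmetric]
    by (subst (asm) mult_le_cancel_left_pos) auto
qed

section \<open>The probability of missing a set of keys\<close>

lemma binomial_step: "(n choose Suc k) * Suc k = (n choose k) * (n - k)"
  using binomial_absorption[of k n] binomial_absorb_comp[of n k] by (simp add: mult.commute)

text \<open>The factors of the falling factorials compare one by one, since
  \<open>(m - 2 s - j) (m - j) \<le> (m - s - j)\<^sup>2\<close>; truncated subtraction does no harm, as a truncated
  factor makes the left-hand side vanish.\<close>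

lemma binomial_log_concave:
  "((m - 2 * s) choose k) * (m choose k) \<le> ((m - s) choose k)\<^sup>2"
proof (induction k)
  case (Suc k)
  have factors: "(m - 2 * s - k) * (m - k) \<le> (m - s - k)\<^sup>2"
  proof (cases "2 * s + k \<le> m")
    case True
    then obtain a where m: "m = 2 * s + k + a" using le_Suc_ex by blast
    show ?thesis by (simp add: m power2_eq_square algebra_simps)
  qed simp
  have "((m - 2 * s) choose Suc k) * (m choose Suc k) * (Suc k)\<^sup>2
      = (((m - 2 * s) choose Suc k) * Suc k) * ((m choose Suc k) * Suc k)"
    by (simp only: power2_eq_square mult_ac)
  also have "\<dots> = (((m - 2 * s) choose k) * (m choose k)) * ((m - 2 * s - k) * (m - k))"
    unfolding binomial_step by (simp only: mult_ac)
  also have "\<dots> \<le> ((m - s) choose k)\<^sup>2 * (m - s - k)\<^sup>2"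
    using Suc factors by (rule mult_le_mono)
  also have "\<dots> = (((m - s) choose Suc k) * Suc k)\<^sup>2"
    by (simp only: binomial_step power_mult_distrib)
  finally show ?case by (simp only: power_mult_distrib mult_le_cancel2) simp
qed simp

text \<open>The probability that the ring of a random node misses a fixed set of \<open>s\<close> keys, by the law of total
  probability over the node's class. At \<open>s = K i\<close> it is \<open>1 - \<lambda>\<^sub>i\<close>.\<close>

definition miss_prob :: "nat pmf \<Rightarrow> (nat \<Rightarrow> nat) \<Rightarrow> nat \<Rightarrow> nat \<Rightarrow> real" where
  "miss_prob \<mu> K P s =
     (\<Sum>j\<in>set_pmf \<mu>. pmf \<mu> j * (real ((P - s) choose K j) / real (P choose K j)))"

lemma miss_prob_nonneg: "0 \<le> miss_prob \<mu> K P s"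
  unfolding miss_prob_def by (intro sum_nonneg mult_nonneg_nonneg divide_nonneg_nonneg) auto

lemma miss_prob_antimono: "s \<le> t \<Longrightarrow> miss_prob \<mu> K P t \<le> miss_prob \<mu> K P s"
  unfolding miss_prob_def
  by (intro sum_mono mult_left_mono divide_right_mono) (auto intro!: binomial_right_mono)

lemma prob_key_ring_pmf:
  assumes "finite (set_pmf \<mu>)"
  shows "measure_pmf.prob (key_ring_pmf \<mu> K P) A =
     (\<Sum>j\<in>set_pmf \<mu>. pmf \<mu> j * measure_pmf.prob (pmf_of_set {S. S \<subseteq> {1..P} \<and> card S = K j}) A)"
  unfolding key_ring_pmf_def prob_bind_pmf
  by (subst integral_measure_pmf[OF assms]) auto

lemma key_rings_finite_nonempty:
  assumes "k \<le> P"
  shows "finite {S. S \<subseteq> {1..P} \<and> card S = k}" "{S. S \<subseteq> {1..P} \<and> card S = k} \<noteq> {}"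
proof -
  show "finite {S. S \<subseteq> {1..P} \<and> card S = k}" by simp
  have "{1..k} \<in> {S. S \<subseteq> {1..P} \<and> card S = k}" using assms by auto
  then show "{S. S \<subseteq> {1..P} \<and> card S = k} \<noteq> {}" by blast
qed

lemma set_key_ring_pmf:
  assumes "\<forall>j\<in>set_pmf \<mu>. K j \<le> P"
  shows "set_pmf (key_ring_pmf \<mu> K P) = (\<Union>j\<in>set_pmf \<mu>. {S. S \<subseteq> {1..P} \<and> card S = K j})"
proof -
  have "set_pmf (pmf_of_set {S. S \<subseteq> {1..P} \<and> card S = K j}) = {S. S \<subseteq> {1..P} \<and> card S = K j}"
    if "j \<in> set_pmf \<mu>" for j
    using key_rings_finite_nonempty[OF bspec[OF assms that]] by (rule set_pmf_of_set[rotated])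
  then show ?thesis unfolding key_ring_pmf_def by simp
qed

lemma prob_key_ring_disjoint:
  assumes "finite (set_pmf \<mu>)" and K: "\<forall>j\<in>set_pmf \<mu>. K j \<le> P" and S: "S \<subseteq> {1..P}"
  shows "measure_pmf.prob (key_ring_pmf \<mu> K P) {T. S \<inter> T = {}} = miss_prob \<mu> K P (card S)"
  unfolding prob_key_ring_pmf[OF assms(1)] miss_prob_def
proof (intro sum.cong refl arg_cong2[where f = times])
  fix j assume j: "j \<in> set_pmf \<mu>"
  let ?U = "{T. T \<subseteq> {1..P} \<and> card T = K j}"
  have "finite S" using S finite_subset by blast
  then have "card ({1..P} - S) = P - card S" using S by (simp add: card_Diff_subset)
  moreover have "?U \<inter> {T. S \<inter> T = {}} = {T. T \<subseteq> {1..P} - S \<and> card T = K j}"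
    by auto
  ultimately have "card (?U \<inter> {T. S \<inter> T = {}}) = (P - card S) choose K j"
    using n_subsets[of "{1..P} - S" "K j"] by simp
  moreover have "card ?U = P choose K j"
    using n_subsets[of "{1..P}" "K j"] by simp
  ultimately show "measure_pmf.prob (pmf_of_set ?U) {T. S \<inter> T = {}}
      = real ((P - card S) choose K j) / real (P choose K j)"
    using key_rings_finite_nonempty[OF bspec[OF K j]] by (simp add: measure_pmf_of_set)
qed

lemma prob_key_ring_size_ge:
  assumes "finite (set_pmf \<mu>)" and K: "\<forall>j\<in>set_pmf \<mu>. K j \<le> P" and i: "i \<in> set_pmf \<mu>"
  shows "pmf \<mu> i \<le> measure_pmf.prob (key_ring_pmf \<mu> K P) {S. card S = K i}"
proof -
  let ?U = "\<lambda>j. {S. S \<subseteq> {1..P} \<and> card S = K j}"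
  have "measure_pmf.prob (pmf_of_set (?U i)) {S. card S = K i} = 1"
    using key_rings_finite_nonempty[OF bspec[OF K i]]
    by (subst measure_pmf.prob_eq_1) (auto simp: AE_measure_pmf_iff set_pmf_of_set)
  then have "pmf \<mu> i = pmf \<mu> i * measure_pmf.prob (pmf_of_set (?U i)) {S. card S = K i}"
    by simp
  also have "\<dots> \<le> measure_pmf.prob (key_ring_pmf \<mu> K P) {S. card S = K i}"
    unfolding prob_key_ring_pmf[OF assms(1)]
    by (rule member_le_sum[OF i _ assms(1)]) auto
  finally show ?thesis .
qed

text \<open>With \<open>w j\<close> the probability that a class-\<open>j\<close> ring meets a set of size \<open>s\<close>, log-concavity bounds the
  left-hand side by the second moment of \<open>1 - w\<close> under \<open>\<mu>\<close>. It exceeds the squared mean by the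
  variance of \<open>w\<close>, at most the mean of \<open>w\<^sup>2\<close>; and \<open>d w j \<le> \<mu>\<^sub>j w j \<le> E w\<close> bounds \<open>w\<close> by \<open>E w / d\<close>.\<close>

lemma miss_prob_double_le:
  assumes fin: "finite (set_pmf \<mu>)" and K: "\<forall>j\<in>set_pmf \<mu>. K j \<le> P"
    and d: "0 < d" "\<And>j. j \<in> set_pmf \<mu> \<Longrightarrow> d \<le> pmf \<mu> j"
  shows "miss_prob \<mu> K P (2 * s) \<le> (miss_prob \<mu> K P s)\<^sup>2 + (1 - miss_prob \<mu> K P s)\<^sup>2 / d"
proof -
  define w where "w j = 1 - real ((P - s) choose K j) / real (P choose K j)" for j
  define L where "L = (\<Sum>j\<in>set_pmf \<mu>. pmf \<mu> j * w j)"
  have one: "(\<Sum>j\<in>set_pmf \<mu>. pmf \<mu> j) = 1"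
    by (rule sum_pmf_eq_1[OF fin subset_refl])
  have miss: "miss_prob \<mu> K P s = 1 - L"
    unfolding L_def w_def miss_prob_def by (simp add: right_diff_distrib sum_subtractf one)
  have pos: "0 < P choose K j" if "j \<in> set_pmf \<mu>" for j
    using bspec[OF K that] by simp
  have w0: "0 \<le> w j" if "j \<in> set_pmf \<mu>" for j
    using pos[OF that] binomial_right_mono[of "P - s" P "K j"] by (simp add: w_def)
  have term_le: "pmf \<mu> j * w j \<le> L" if "j \<in> set_pmf \<mu>" for j
    unfolding L_def by (rule member_le_sum[OF that _ fin]) (simp add: w0)
  have w_le: "w j \<le> L / d" if "j \<in> set_pmf \<mu>" for j
  proof -
    have "d * w j \<le> pmf \<mu> j * w j" using d(2)[OF that] w0[OF that] by (rule mult_right_mono)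
    also have "\<dots> \<le> L" using that by (rule term_le)
    finally show ?thesis using d(1) by (simp add: field_simps)
  qed
  have sq: "real ((P - 2 * s) choose K j) / real (P choose K j) \<le> (1 - w j)\<^sup>2"
    if "j \<in> set_pmf \<mu>" for j
  proof -
    have "real ((P - 2 * s) choose K j) * real (P choose K j) \<le> (real ((P - s) choose K j))\<^sup>2"
      using binomial_log_concave[of P s "K j"] by (metis of_nat_le_iff of_nat_mult of_nat_power)
    then show ?thesis
      using pos[OF that] by (simp add: w_def power_divide field_simps power2_eq_square)
  qed
  have "miss_prob \<mu> K P (2 * s) \<le> (\<Sum>j\<in>set_pmf \<mu>. pmf \<mu> j * (1 - w j)\<^sup>2)"
    unfolding miss_prob_def by (intro sum_mono mult_left_mono sq) auto
  also have "\<dots> = (\<Sum>j\<in>set_pmf \<mu>. pmf \<mu> j - 2 * (pmf \<mu> j * w j) + (pmf \<mu> j * w j) * w j)"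
    by (intro sum.cong refl) (simp add: power2_eq_square algebra_simps)
  also have "\<dots> = 1 - 2 * L + (\<Sum>j\<in>set_pmf \<mu>. (pmf \<mu> j * w j) * w j)"
    by (simp add: sum.distrib sum_subtractf sum_distrib_left[symmetric] one L_def)
  also have "(\<Sum>j\<in>set_pmf \<mu>. (pmf \<mu> j * w j) * w j) \<le> (\<Sum>j\<in>set_pmf \<mu>. (pmf \<mu> j * w j) * (L / d))"
    by (intro sum_mono mult_left_mono w_le) (auto simp: w0)
  also have "\<dots> = L\<^sup>2 / d"
    by (simp only: sum_distrib_right[symmetric] L_def[symmetric]) (simp add: power2_eq_square)
  also have "1 - 2 * L + L\<^sup>2 / d \<le> (1 - L)\<^sup>2 + L\<^sup>2 / d"
    by (simp add: power2_eq_square algebra_simps)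
  finally show ?thesis by (simp add: miss)
qed

section \<open>Isolated nodes for a fixed number of nodes\<close>

lemma isolated_node_iff:
  "isolated_node {1..n} (key_graph_edges n f) x \<longleftrightarrow> x \<in> {1..n} \<and> avoids_others {1..n} f x"
proof -
  have "{x, y} \<in> key_graph_edges n f \<longleftrightarrow> x \<noteq> y \<and> f x \<inter> f y \<noteq> {}"
    if "x \<in> {1..n}" "y \<in> {1..n}" for y
    unfolding key_graph_edges_def mem_Collect_eq doubleton_eq_iff using that by blast
  then show ?thesis
    unfolding isolated_node_def avoids_others_def by blast
qed

lemma prob_no_isolated:
  "measure_pmf.prob (random_key_graph n \<mu> K P) {E. \<not> (\<exists>x. isolated_node {1..n} E x)}
   = measure_pmf.prob (Pi_pmf {1..n} {} (\<lambda>_. key_ring_pmf \<mu> K P))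
       {f. \<forall>x\<in>{1..n}. \<not> avoids_others {1..n} f x}"
  unfolding random_key_graph_def measure_map_pmf
  by (rule arg_cong[where f = "measure_pmf.prob _"]) (auto simp only: isolated_node_iff vimage_Collect_eq)

text \<open>Union bound over the nodes: all rings have at least \<open>s\<close> keys, so each node is isolated with
  probability at most that of a node with exactly \<open>s\<close> keys.\<close>

lemma prob_no_isolated_ge:
  assumes "finite (set_pmf \<mu>)" and K: "\<forall>j\<in>set_pmf \<mu>. K j \<le> P"
    and s: "\<And>j. j \<in> set_pmf \<mu> \<Longrightarrow> s \<le> K j"
  shows "1 - real n * miss_prob \<mu> K P s ^ (n - 1)
    \<le> measure_pmf.prob (random_key_graph n \<mu> K P) {E. \<not> (\<exists>x. isolated_node {1..n} E x)}"
proof -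
  let ?D = "key_ring_pmf \<mu> K P" and ?V = "{1..n}"
  let ?M = "Pi_pmf ?V {} (\<lambda>_. ?D)"
  have miss: "measure_pmf.prob ?D {T. S \<inter> T = {}} \<le> miss_prob \<mu> K P s" if S: "S \<in> set_pmf ?D" for S
  proof -
    obtain j where j: "j \<in> set_pmf \<mu>" "S \<subseteq> {1..P}" "card S = K j"
      using S unfolding set_key_ring_pmf[OF K] by blast
    then show ?thesis
      using prob_key_ring_disjoint[OF assms(1) K j(2)] miss_prob_antimono s by simp
  qed
  have "measure_pmf.prob ?M (\<Union>x\<in>?V. {f. avoids_others ?V f x})
      \<le> (\<Sum>x\<in>?V. measure_pmf.prob ?M {f. avoids_others ?V f x})"
    by (rule measure_pmf.finite_measure_subadditive_finite) auto
  also have "\<dots> \<le> (\<Sum>x\<in>?V. miss_prob \<mu> K P s ^ (card ?V - 1))"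
    by (intro sum_mono prob_avoids_others_le miss) auto
  finally have union: "measure_pmf.prob ?M (\<Union>x\<in>?V. {f. avoids_others ?V f x})
      \<le> real n * miss_prob \<mu> K P s ^ (n - 1)"
    by simp
  have compl: "{f. \<forall>x\<in>?V. \<not> avoids_others ?V f x} = UNIV - (\<Union>x\<in>?V. {f. avoids_others ?V f x})"
    by auto
  have "measure_pmf.prob ?M {f. \<forall>x\<in>?V. \<not> avoids_others ?V f x}
      = 1 - measure_pmf.prob ?M (\<Union>x\<in>?V. {f. avoids_others ?V f x})"
    unfolding compl using measure_pmf.prob_compl[of "\<Union>x\<in>?V. {f. avoids_others ?V f x}" ?M] by simp
  then show ?thesis
    unfolding prob_no_isolated using union by linarith
qed

text \<open>The second moment method for the isolated nodes with a ring of size \<open>K i\<close>. The probability \<open>m\<close> of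
  that ring size cancels in the ratio of the second moment to the squared first moment; elsewhere
  it is only bounded below, by \<open>pmf \<mu> i\<close>, because other classes may have the same ring size.\<close>

lemma prob_no_isolated_le:
  assumes "finite (set_pmf \<mu>)" and K: "\<forall>j\<in>set_pmf \<mu>. K j \<le> P"
    and i: "i \<in> set_pmf \<mu>" and "n \<ge> 2"
  defines "t \<equiv> miss_prob \<mu> K P (K i)"
  assumes t: "0 < t"
  shows "measure_pmf.prob (random_key_graph n \<mu> K P) {E. \<not> (\<exists>x. isolated_node {1..n} E x)}
    \<le> 1 / (pmf \<mu> i * (real n * t ^ (n - 1))) + (miss_prob \<mu> K P (2 * K i) / t\<^sup>2) ^ (n - 2) / t\<^sup>2 - 1"
proof -
  let ?D = "key_ring_pmf \<mu> K P" and ?V = "{1..n}" and ?B = "{S. card S = K i}"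
  let ?M = "Pi_pmf ?V {} (\<lambda>_. ?D)"
  define u where "u = miss_prob \<mu> K P (2 * K i)"
  define m where "m = measure_pmf.prob ?D ?B"
  define A where "A x = {f :: nat \<Rightarrow> nat set. f x \<in> ?B \<and> avoids_others ?V f x}" for x
  have m: "0 < pmf \<mu> i" "pmf \<mu> i \<le> m"
    using i prob_key_ring_size_ge[OF assms(1) K i] by (simp_all add: m_def pmf_positive)
  have sub: "S \<subseteq> {1..P}" if "S \<in> set_pmf ?D" for S
    using that unfolding set_key_ring_pmf[OF K] by blast
  have one: "measure_pmf.prob ?M (A x) = m * t ^ (n - 1)" if "x \<in> ?V" for x
  proof -
    have "measure_pmf.prob ?M (A x) = measure_pmf.prob ?D ?B * t ^ (card ?V - 1)"
      unfolding A_def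
      by (rule prob_avoids_others_eq[OF _ that])
         (auto simp: prob_key_ring_disjoint[OF assms(1) K sub] t_def)
    then show ?thesis by (simp add: m_def)
  qed
  have two: "measure_pmf.prob ?M (A x \<inter> A y) \<le> m\<^sup>2 * u ^ (n - 2)"
    if "x \<in> ?V" "y \<in> ?V" "x \<noteq> y" for x y
  proof -
    have "measure_pmf.prob ?M (A x \<inter> A y) \<le> (measure_pmf.prob ?D ?B)\<^sup>2 * u ^ (card ?V - 2)"
      unfolding A_def
    proof (rule prob_two_avoid_others_le[OF _ that])
      fix S T assume ST: "S \<in> set_pmf ?D" "T \<in> set_pmf ?D" "S \<in> ?B" "T \<in> ?B" "S \<inter> T = {}"
      have "card (S \<union> T) = 2 * K i"
        using ST finite_subset[OF sub[OF ST(1)]] finite_subset[OF sub[OF ST(2)]]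
        by (simp add: card_Un_disjoint)
      then show "measure_pmf.prob ?D {R. (S \<union> T) \<inter> R = {}} \<le> u"
        using prob_key_ring_disjoint[OF assms(1) K, of "S \<union> T"] sub[OF ST(1)] sub[OF ST(2)]
        by (simp add: u_def)
    qed (simp_all add: u_def miss_prob_nonneg)
    then show ?thesis by (simp add: m_def)
  qed
  have "measure_pmf.prob ?M {f. \<forall>x\<in>?V. \<not> avoids_others ?V f x}
      \<le> measure_pmf.prob ?M {f. \<forall>x\<in>?V. f \<notin> A x}"
    by (rule measure_pmf.finite_measure_mono) (auto simp: A_def)
  also have "\<dots> \<le> 1 / (card ?V * (m * t ^ (n - 1))) + m\<^sup>2 * u ^ (n - 2) / (m * t ^ (n - 1))\<^sup>2 - 1"
    by (rule prob_no_event_le[OF _ _ _ _ one two])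
       (use m t \<open>n \<ge> 2\<close> in \<open>auto simp: u_def miss_prob_nonneg\<close>)
  also have "m\<^sup>2 * u ^ (n - 2) / (m * t ^ (n - 1))\<^sup>2 = (u / t\<^sup>2) ^ (n - 2) / t\<^sup>2"
  proof -
    obtain k where "n = k + 2" using \<open>n \<ge> 2\<close> by (metis le_add_diff_inverse2)
    then show ?thesis
      using m by (simp add: power_mult_distrib power_divide flip: power_mult)
                 (simp add: power_add mult_ac power2_eq_square flip: power_mult)
  qed
  also have "1 / (card ?V * (m * t ^ (n - 1))) \<le> 1 / (pmf \<mu> i * (real n * t ^ (n - 1)))"
    using m t \<open>n \<ge> 2\<close> by (intro divide_left_mono) (auto intro!: mult_right_mono mult_pos_pos simp: mult.left_commute)
  finally show ?thesis
    unfolding prob_no_isolated u_def by simp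
qed

section \<open>Asymptotics\<close>

lemma scaling_bounds:
  assumes "scaling r K P" "n \<ge> 2" "j \<in> {1..r}"
  shows "K 1 n \<le> K j n" and "K j n < P n"
proof -
  have next_class: "K i n \<le> K (Suc i) n" if "i \<in> {1..<r}" for i
    using assms that by (auto simp: scaling_def)
  have mono: "K i n \<le> K l n" if "i \<le> l" "1 \<le> i" "l \<le> r" for i l
    using that(1,3)
  proof (induction l rule: dec_induct)
    case (step l)
    then show ?case using next_class[of l] that(2) by force
  qed simp
  show "K 1 n \<le> K j n" using assms(3) by (intro mono) auto
  have "K j n \<le> K r n" using assms(3) by (intro mono) auto
  also have "K r n < P n" using assms(1,2) by (simp add: scaling_def)
  finally show "K j n < P n" .
qed

lemma one_minus_mean_edge_prob:
  assumes "set_pmf \<mu> = {1..r}"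
  shows "1 - mean_edge_prob r \<mu> K P i n = miss_prob \<mu> (\<lambda>j. K j n) (P n) (K i n)"
proof -
  have "(\<Sum>j=1..r. pmf \<mu> j) = 1"
    using assms by (intro sum_pmf_eq_1) auto
  then show ?thesis
    unfolding mean_edge_prob_def edge_prob_def miss_prob_def assms
    by (simp add: left_diff_distrib right_diff_distrib sum_subtractf mult.commute)
qed

lemma asymp_equiv_eventually_between:
  fixes f g :: "nat \<Rightarrow> real"
  assumes "asymp_equiv f at_top g" "eventually (\<lambda>n. 0 < g n) at_top" "a < 1" "1 < b"
  shows "eventually (\<lambda>n. a * g n \<le> f n \<and> f n \<le> b * g n) at_top"
proof -
  have lim: "((\<lambda>n. if f n = 0 \<and> g n = 0 then 1 else f n / g n) \<longlongrightarrow> 1) at_top"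
    using assms(1) by (rule asymp_equivD)
  show ?thesis
    using order_tendstoD(1)[OF lim assms(3)] order_tendstoD(2)[OF lim assms(4)] assms(2)
    by eventually_elim (auto simp: field_simps)
qed

text \<open>By \<open>1 - x \<le> exp (- x)\<close> the expression is at most about \<open>n\<^sup>1\<^sup>-\<^sup>c\<close>.\<close>

lemma union_bound_tendsto_0:
  fixes t :: "nat \<Rightarrow> real"
  assumes "c > 1" "eventually (\<lambda>n. 0 \<le> t n \<and> t n \<le> 1 - c * (ln (real n) / real n)) at_top"
  shows "((\<lambda>n. real n * t n ^ (n - 1)) \<longlongrightarrow> 0) at_top"
proof (rule tendsto_sandwich)
  show "((\<lambda>_::nat. 0::real) \<longlongrightarrow> 0) at_top" by simp
  show "((\<lambda>n. real n * exp (- ((real n - 1) * (c * (ln (real n) / real n))))) \<longlongrightarrow> 0) at_top"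
    using assms(1) by real_asymp
  show "eventually (\<lambda>n. 0 \<le> real n * t n ^ (n - 1)) at_top"
    using assms(2) by eventually_elim simp
  show "eventually (\<lambda>n. real n * t n ^ (n - 1) \<le>
      real n * exp (- ((real n - 1) * (c * (ln (real n) / real n))))) at_top"
    using assms(2) eventually_ge_at_top[of 1]
  proof eventually_elim
    case (elim n)
    define e where "e = c * (ln (real n) / real n)"
    have "t n ^ (n - 1) \<le> exp (- e) ^ (n - 1)"
      using elim exp_ge_add_one_self[of "- e"] by (intro power_mono) (auto simp: e_def)
    also have "\<dots> = exp (- ((real n - 1) * e))"
      using elim by (simp add: exp_of_nat_mult[symmetric] of_nat_diff)
    finally show ?case by (simp add: e_def mult_left_mono)
  qed
qed

text \<open>The first summand of the bound on \<open>q\<close> is controlled by \<open>ln (1 - x) \<ge> - x - 2 x\<^sup>2\<close> for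
  \<open>x \<le> 1 / 2\<close>: then \<open>n t\<^sup>n\<close> is at least about \<open>n\<^sup>1\<^sup>-\<^sup>c\<close>. In the second, \<open>u / t\<^sup>2\<close> exceeds 1 by at most
  a constant times \<open>(ln n / n)\<^sup>2\<close>, so its power of order \<open>n\<close> still tends to 1.\<close>

lemma second_moment_bound_tendsto_0:
  fixes t u :: "nat \<Rightarrow> real"
  assumes c: "0 < c" "c < 1" and "0 < m" "0 < d"
    and t: "eventually (\<lambda>n. 1 - c * (ln (real n) / real n) \<le> t n \<and> t n \<le> 1) at_top"
    and u: "eventually (\<lambda>n. 0 \<le> u n \<and> u n \<le> (t n)\<^sup>2 + (1 - t n)\<^sup>2 / d) at_top"
    and q: "eventually (\<lambda>n. 0 \<le> q n \<and>
       q n \<le> 1 / (m * (real n * t n ^ (n - 1))) + (u n / (t n)\<^sup>2) ^ (n - 2) / (t n)\<^sup>2 - 1) at_top"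
  shows "(q \<longlongrightarrow> 0) at_top"
proof (rule tendsto_sandwich)
  show "((\<lambda>_::nat. 0::real) \<longlongrightarrow> 0) at_top" by simp
  define e where "e n = c * (ln (real n) / real n)" for n
  define first where "first n = real n * exp (- (real n * (e n + 2 * (e n)\<^sup>2)))" for n
  define second where "second n = exp (real n * (4 * (e n)\<^sup>2 / d)) / (1 - e n)\<^sup>2" for n
  have "filterlim first at_top at_top"
    unfolding first_def e_def using c by real_asymp
  then have "((\<lambda>n. 1 / (m * first n)) \<longlongrightarrow> 0) at_top"
    using \<open>0 < m\<close>
    by (intro real_tendsto_divide_at_top[OF tendsto_const] filterlim_tendsto_pos_mult_at_top[OF tendsto_const])
  moreover have "(second \<longlongrightarrow> 1) at_top"
    unfolding second_def e_def using c \<open>0 < d\<close> by real_asymp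
  ultimately have "((\<lambda>n. 1 / (m * first n) + second n - 1) \<longlongrightarrow> 0 + 1 - 1) at_top"
    by (intro tendsto_intros)
  then show "((\<lambda>n. 1 / (m * first n) + second n - 1) \<longlongrightarrow> 0) at_top" by simp
  show "eventually (\<lambda>n. 0 \<le> q n) at_top" using q by eventually_elim simp
  have "(e \<longlongrightarrow> 0) at_top" unfolding e_def by real_asymp
  then have "eventually (\<lambda>n. e n < 1 / 2) at_top" by (rule order_tendstoD) simp
  with t u q eventually_ge_at_top[of 2]
  show "eventually (\<lambda>n. q n \<le> 1 / (m * first n) + second n - 1) at_top"
  proof eventually_elim
    case (elim n)
    have e: "0 \<le> e n" "1 - e n \<le> t n" "t n \<le> 1" "e n < 1 / 2" "1 / 2 < 1 - e n"
      using elim c by (simp_all add: e_def)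
    have "exp (- (e n + 2 * (e n)\<^sup>2)) \<le> exp (ln (1 - e n))"
      using ln_one_minus_pos_lower_bound[of "e n"] e unfolding exp_le_cancel_iff by linarith
    also have "\<dots> \<le> t n" using e by simp
    finally have "exp (- (e n + 2 * (e n)\<^sup>2)) ^ n \<le> t n ^ n" by (intro power_mono) auto
    also have "t n ^ n \<le> t n ^ (n - 1)" using e by (intro power_decreasing) auto
    finally have first: "first n \<le> real n * t n ^ (n - 1)"
      using exp_of_nat_mult[of n "- (e n + 2 * (e n)\<^sup>2)"]
      by (simp only: first_def mult_minus_right mult_left_mono of_nat_0_le_iff)
    have "0 < first n" using elim by (simp add: first_def)
    then have "0 < m * first n" "m * first n \<le> m * (real n * t n ^ (n - 1))"
      using first \<open>0 < m\<close> by simp_all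
    then have f: "1 / (m * (real n * t n ^ (n - 1))) \<le> 1 / (m * first n)"
      by (intro frac_le) auto
    \<comment> \<open>The constant 4 in \<open>second\<close> is the reciprocal of this lower bound on \<open>t\<^sup>2\<close>.\<close>
    have t2: "1 / 4 \<le> (t n)\<^sup>2" using power_mono[of "1 / 2" "t n" 2] e by (simp add: power_divide)
    have "u n / (t n)\<^sup>2 \<le> ((t n)\<^sup>2 + (1 - t n)\<^sup>2 / d) / (t n)\<^sup>2"
      using elim by (intro divide_right_mono) auto
    also have "\<dots> = 1 + (1 - t n)\<^sup>2 / (d * (t n)\<^sup>2)"
      using t2 \<open>0 < d\<close> by (auto simp: add_divide_distrib)
    also have "(1 - t n)\<^sup>2 / (d * (t n)\<^sup>2) \<le> (e n)\<^sup>2 / (d * (1 / 4))"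
      using e t2 \<open>0 < d\<close> by (intro frac_le power_mono mult_left_mono) auto
    also have "1 + (e n)\<^sup>2 / (d * (1 / 4)) \<le> exp (4 * (e n)\<^sup>2 / d)"
      using exp_ge_add_one_self[of "4 * (e n)\<^sup>2 / d"] by (simp add: mult.commute)
    finally have "(u n / (t n)\<^sup>2) ^ (n - 2) \<le> exp (4 * (e n)\<^sup>2 / d) ^ (n - 2)"
      using elim by (intro power_mono) auto
    also have "\<dots> \<le> exp (4 * (e n)\<^sup>2 / d) ^ n"
      using \<open>0 < d\<close> by (intro power_increasing) auto
    also have "\<dots> = exp (real n * (4 * (e n)\<^sup>2 / d))"
      by (rule exp_of_nat_mult[symmetric])
    finally have "(u n / (t n)\<^sup>2) ^ (n - 2) / (t n)\<^sup>2 \<le> second n"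
      unfolding second_def using e by (intro frac_le power_mono) auto
    with f elim show ?case by linarith
  qed
qed

theorem theorem3p1:
  fixes r :: nat and \<mu> :: "nat pmf"
    and K :: "nat \<Rightarrow> nat \<Rightarrow> nat" and P :: "nat \<Rightarrow> nat" and c :: real
  assumes "r \<ge> 1"
    and "set_pmf \<mu> = {1..r}"
    and "scaling r K P"
    and "c > 0"
    and "asymp_equiv (mean_edge_prob r \<mu> K P 1) at_top (\<lambda>n. c * (ln (real n) / real n))"
  shows "(c < 1 \<longrightarrow>
           (\<lambda>n. measure_pmf.prob (random_key_graph n \<mu> (\<lambda>i. K i n) (P n))
                  {E. \<not> (\<exists>x. isolated_node {1..n} E x)}) \<longlonglongrightarrow> 0) \<and>
         (c > 1 \<longrightarrow>
           (\<lambda>n. measure_pmf.prob (random_key_graph n \<mu> (\<lambda>i. K i n) (P n))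
                  {E. \<not> (\<exists>x. isolated_node {1..n} E x)}) \<longlonglongrightarrow> 1)"
proof -
  define q where "q n = measure_pmf.prob (random_key_graph n \<mu> (\<lambda>i. K i n) (P n))
      {E. \<not> (\<exists>x. isolated_node {1..n} E x)}" for n
  define g where "g n = c * (ln (real n) / real n)" for n
  \<comment> \<open>\<open>t\<close> is \<open>1 - \<lambda>\<^sub>1\<close>; \<open>u\<close> is the probability that a ring misses two given disjoint class-1 rings.\<close>
  define t where "t n = miss_prob \<mu> (\<lambda>i. K i n) (P n) (K 1 n)" for n
  define u where "u n = miss_prob \<mu> (\<lambda>i. K i n) (P n) (2 * K 1 n)" for n
  have fin: "finite (set_pmf \<mu>)" and one: "1 \<in> set_pmf \<mu>"
    using assms(1,2) by auto
  have L: "mean_edge_prob r \<mu> K P 1 n = 1 - t n" for n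
    using one_minus_mean_edge_prob[OF assms(2), of K P 1 n] by (simp add: t_def)
  have KP: "\<forall>j\<in>set_pmf \<mu>. K j n \<le> P n" if "n \<ge> 2" for n
    using scaling_bounds(2)[OF assms(3) that] assms(2) by (auto simp: less_imp_le)
  have g_pos: "eventually (\<lambda>n. 0 < g n) at_top"
    using eventually_ge_at_top[of 2]
    by eventually_elim (use assms(4) in \<open>simp add: g_def\<close>)
  have between: "eventually (\<lambda>n. a * g n \<le> 1 - t n \<and> 1 - t n \<le> b * g n) at_top"
    if "a < 1" "1 < b" for a b
    using asymp_equiv_eventually_between[OF assms(5)[folded g_def] g_pos that] unfolding L .
  have "(q \<longlongrightarrow> 1) at_top" if "c > 1"
  proof (rule tendsto_sandwich)
    \<comment> \<open>A constant strictly between 1 and \<open>c\<close> absorbs the error of the asymptotic equivalence.\<close>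
    define c' where "c' = (1 + c) / 2"
    have c': "1 < c'" "c' / c < 1" using that by (simp_all add: c'_def)
    have "eventually (\<lambda>n. 0 \<le> t n \<and> t n \<le> 1 - c' * (ln (real n) / real n)) at_top"
      using between[OF c'(2) that] by eventually_elim (use that in \<open>auto simp: g_def t_def miss_prob_nonneg\<close>)
    then have "((\<lambda>n. real n * t n ^ (n - 1)) \<longlongrightarrow> 0) at_top"
      using c'(1) by (rule union_bound_tendsto_0[rotated])
    from tendsto_diff[OF tendsto_const this, of 1]
    show "((\<lambda>n. 1 - real n * t n ^ (n - 1)) \<longlongrightarrow> 1) at_top" by simp
    show "((\<lambda>_::nat. 1::real) \<longlongrightarrow> 1) at_top" by simp
    show "eventually (\<lambda>n. q n \<le> 1) at_top" by (simp add: q_def)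
    show "eventually (\<lambda>n. 1 - real n * t n ^ (n - 1) \<le> q n) at_top"
      using eventually_ge_at_top[of 2]
    proof eventually_elim
      case (elim n)
      show ?case
        unfolding q_def t_def
        by (rule prob_no_isolated_ge[OF fin KP[OF elim]])
           (use scaling_bounds(1)[OF assms(3) elim] assms(2) in auto)
    qed
  qed
  moreover have "(q \<longlongrightarrow> 0) at_top" if "c < 1"
  proof -
    \<comment> \<open>Here the constant lies strictly between \<open>c\<close> and 1.\<close>
    define c' where "c' = (1 + c) / 2"
    have c': "0 < c'" "c' < 1" "1 < c' / c" using that assms(4) by (simp_all add: c'_def)
    define d where "d = Min (pmf \<mu> ` set_pmf \<mu>)"
    have "pmf \<mu> ` set_pmf \<mu> \<noteq> {}" using one by blast
    then have d: "0 < d" "\<And>j. j \<in> set_pmf \<mu> \<Longrightarrow> d \<le> pmf \<mu> j"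
      using fin by (auto simp: d_def Min_gr_iff pmf_positive)
    have t: "eventually (\<lambda>n. 1 - c' * (ln (real n) / real n) \<le> t n \<and> t n \<le> 1) at_top"
      using between[OF zero_less_one c'(3)] by eventually_elim (use assms(4) in \<open>auto simp: g_def\<close>)
    have "((\<lambda>n. c' * (ln (real n) / real n)) \<longlongrightarrow> 0) at_top" by real_asymp
    then have "eventually (\<lambda>n. c' * (ln (real n) / real n) < 1) at_top"
      by (rule order_tendstoD) simp
    with t have t_pos: "eventually (\<lambda>n. 0 < t n) at_top" by eventually_elim simp
    have u: "eventually (\<lambda>n. 0 \<le> u n \<and> u n \<le> (t n)\<^sup>2 + (1 - t n)\<^sup>2 / d) at_top"
      using eventually_ge_at_top[of 2]
      by eventually_elim
         (auto simp: u_def t_def miss_prob_nonneg intro!: miss_prob_double_le[OF fin KP d])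
    have "eventually (\<lambda>n. 0 \<le> q n \<and>
       q n \<le> 1 / (pmf \<mu> 1 * (real n * t n ^ (n - 1))) + (u n / (t n)\<^sup>2) ^ (n - 2) / (t n)\<^sup>2 - 1) at_top"
      using t_pos eventually_ge_at_top[of 2]
    proof eventually_elim
      case (elim n)
      then show ?case
        unfolding q_def t_def u_def
        using prob_no_isolated_le[OF fin KP[OF elim(2)] one elim(2)] by simp
    qed
    with c'(1,2) pmf_positive[OF one] d(1) t u show ?thesis
      by (rule second_moment_bound_tendsto_0)
  qed
  ultimately show ?thesis unfolding q_def by blast
qed

end
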